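(* Let $K \subset \mathbb{R}^d$ be a compact set and let $F_1, F_2, \ldots, F_{d+1}$ be closed subsets of $K$. Suppose that for every choice $f_1 \in F_1, f_2 \in F_2, \ldots, f_{d+1} \in F_{d+1}$ there exists a point $x \in K$ such that $[x, f_i] \subset F_i$ for each $i \in \{1,\dots,d+1\}$. Then there exists $i \in \{1,\dots,d+1\}$ such that $F_i$ is star-shaped.
   Context: $[x,y]$ denotes the closed segment between $x$ and $y$. A set $A \subset \mathbb{R}^d$ is star-shaped if there exists $x \in A$ such that $[x,y] \subset A$ for every $y \in A$.
   Formalization: The sets F_1,…,F_{d+1} are additionally assumed nonempty (if some F_i is empty the hypothesis on choices is vacuous and the claim can fail, since the empty set is not star-shaped), and d ≥ 1. *)

theory Defs
  imports "HOL-Analysis.Analysis"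
begin

end

theory Submission
  imports Defs
begin

text \<open>
  For a closed bounded set \<open>A\<close>, the sets \<open>{x. closed_segment x y \<subseteq> A}\<close> with \<open>y \<in> A\<close>
  intersect in the kernel of \<open>A\<close>, and by Krasnoselskii's argument so do their convex hulls.
  Applied to these convex hulls, Barany's colourful Helly theorem says that one of the kernels
  is non-empty.

  The colourful Helly theorem is proved by an extremal argument: among all choices of one set
  from all families but one, take one for which the point of the intersection nearest to the
  origin is as far away as possible. This point lies in every set of the omitted family, because
  by Helly's theorem the nearest point of the intersection of \<open>d + 1\<close> sets has the same norm
  as the nearest point of the intersection of some \<open>d\<close> of them.
\<close>

section \<open>The colourful Helly theorem\<close>

text \<open>Distinct indices may carry equal sets. Choosing an index set on which \<open>S\<close>
  is injective makes the two cardinalities agree, so Helly's theorem for sets of sets applies; with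
  too few distinct sets for it, \<open>meet\<close> suffices directly.\<close>

lemma helly_indexed:
  fixes S :: "'i \<Rightarrow> 'a::euclidean_space set"
  assumes "finite I"
    and conv: "\<And>i. i \<in> I \<Longrightarrow> convex (S i)"
    and meet: "\<And>J. J \<subseteq> I \<Longrightarrow> card J \<le> DIM('a) + 1 \<Longrightarrow> (\<Inter>i\<in>J. S i) \<noteq> {}"
  shows "(\<Inter>i\<in>I. S i) \<noteq> {}"
proof (cases "card (S ` I) \<ge> DIM('a) + 1")
  case True
  have "\<Inter> (S ` I) \<noteq> {}"
  proof (rule Helly[OF True])
    show "\<forall>s\<in>S ` I. convex s"
      using conv by blast
  next
    fix t
    assume "t \<subseteq> S ` I" and "card t = DIM('a) + 1"
    then obtain J where "J \<subseteq> I" "inj_on S J" "t = S ` J"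
      using subset_image_inj by metis
    with \<open>card t = DIM('a) + 1\<close> show "\<Inter> t \<noteq> {}"
      using meet[of J] by (simp add: card_image)
  qed
  then show ?thesis .
next
  case False
  have "\<exists>J\<subseteq>I. inj_on S J \<and> S ` I = S ` J"
    by (rule subset_image_inj[THEN iffD1]) simp
  then obtain J where "J \<subseteq> I" "inj_on S J" "S ` I = S ` J"
    by (elim exE conjE)
  then have "card J = card (S ` I)"
    by (simp add: card_image)
  with False have "(\<Inter>i\<in>J. S i) \<noteq> {}"
    using \<open>J \<subseteq> I\<close> by (intro meet) auto
  then show ?thesis
    by (simp only: \<open>S ` I = S ` J\<close> not_False_eq_True)
qed

text \<open>If omitting any one set let the rest meet the open ball of radius \<open>r\<close>,
  Helly's theorem for the sets together with this ball, indexed by \<open>None\<close>, would give a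
  common point of norm below \<open>r\<close>.\<close>

lemma Inter_disjoint_ball_imp_subfamily:
  fixes S :: "'i \<Rightarrow> 'a::euclidean_space set"
  assumes "finite I" and card_I: "card I = DIM('a) + 1"
    and conv: "\<And>i. i \<in> I \<Longrightarrow> convex (S i)"
    and ne: "(\<Inter>i\<in>I. S i) \<noteq> {}"
    and far: "\<And>x. x \<in> (\<Inter>i\<in>I. S i) \<Longrightarrow> r \<le> norm x"
  obtains j where "j \<in> I" "\<And>x. x \<in> (\<Inter>i\<in>I - {j}. S i) \<Longrightarrow> r \<le> norm x"
proof (rule ccontr)
  assume "\<not> thesis"
  with that have near: "\<And>j. j \<in> I \<Longrightarrow> \<exists>x \<in> (\<Inter>i\<in>I - {j}. S i). norm x < r"
    by (meson not_le)
  define T where "T k = (case k of None \<Rightarrow> ball 0 r | Some i \<Rightarrow> S i)" for k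
  have "(\<Inter>k\<in>insert None (Some ` I). T k) \<noteq> {}"
  proof (rule helly_indexed)
    show "finite (insert None (Some ` I))"
      using \<open>finite I\<close> by simp
    show "convex (T k)" if "k \<in> insert None (Some ` I)" for k
      using that conv by (auto simp: T_def)
    show "(\<Inter>k\<in>J. T k) \<noteq> {}"
      if J: "J \<subseteq> insert None (Some ` I)" "card J \<le> DIM('a) + 1" for J
    proof (cases "None \<in> J")
      case False
      then have "J \<subseteq> Some ` I"
        using J by blast
      then show ?thesis
        using ne by (fastforce simp: T_def)
    next
      case True
      \<comment> \<open>All indices together number one more than \<open>J\<close> may contain, so
        once the ball is in \<open>J\<close>, some \<open>S j\<close> is left out and
        \<open>near\<close> applies.\<close>
      have "\<not> Some ` I \<subseteq> J"
      proof
        assume "Some ` I \<subseteq> J"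
        then have "J = insert None (Some ` I)"
          using J True by blast
        then have "card J = card I + 1"
          using \<open>finite I\<close> by (simp add: card_insert_if card_image)
        then show False
          using J card_I by simp
      qed
      then obtain j where "j \<in> I" "Some j \<notin> J"
        by blast
      with near obtain x where "x \<in> (\<Inter>i\<in>I - {j}. S i)" "norm x < r"
        by blast
      then have "x \<in> T k" if "k \<in> J" for k
        using that J \<open>Some j \<notin> J\<close> by (cases k) (auto simp: T_def)
      then show ?thesis
        by blast
    qed
  qed
  then show False
    using far by (fastforce simp: T_def)
qed

theorem colourful_helly_finite:
  fixes G :: "'i \<Rightarrow> 'a::euclidean_space set set"
  assumes "finite I" and card_I: "card I = DIM('a) + 1"
    and fin: "\<And>i. i \<in> I \<Longrightarrow> finite (G i)"
    and clos: "\<And>i S. i \<in> I \<Longrightarrow> S \<in> G i \<Longrightarrow> closed S"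
    and conv: "\<And>i S. i \<in> I \<Longrightarrow> S \<in> G i \<Longrightarrow> convex S"
    and meet: "\<And>g. g \<in> Pi I G \<Longrightarrow> (\<Inter>i\<in>I. g i) \<noteq> {}"
  shows "\<exists>i\<in>I. \<Inter>(G i) \<noteq> {}"
proof (cases "\<exists>i\<in>I. G i = {}")
  \<comment> \<open>The intersection of an empty family is the whole space.\<close>
  case True
  then show ?thesis by force
next
  case False
  define p where "p j g = closest_point (\<Inter>i\<in>I - {j}. g i) (0::'a)" for j g
  have part: "closed (\<Inter>i\<in>J. g i) \<and> convex (\<Inter>i\<in>J. g i) \<and> (\<Inter>i\<in>J. g i) \<noteq> {}"
    if "g \<in> Pi I G" "J \<subseteq> I" for g J
  proof -
    have "closed (g i)" "convex (g i)" if "i \<in> J" for i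
      using that clos[of i "g i"] conv[of i "g i"] \<open>g \<in> Pi I G\<close> \<open>J \<subseteq> I\<close> by auto
    moreover have "(\<Inter>i\<in>J. g i) \<noteq> {}"
      using meet[OF \<open>g \<in> Pi I G\<close>] \<open>J \<subseteq> I\<close> by blast
    ultimately show ?thesis
      by (simp add: closed_INT convex_INT)
  qed
  have I_ne: "I \<noteq> {}"
    using card_I by auto
  \<comment> \<open>Extensional choice functions keep the search space finite, so the norm of
    \<open>p k h\<close> attains a maximum.\<close>
  have "finite (I \<times> Pi\<^sub>E I G)"
    using \<open>finite I\<close> fin by (simp add: finite_PiE)
  moreover have "I \<times> Pi\<^sub>E I G \<noteq> {}"
    using False I_ne by (auto simp: PiE_eq_empty_iff)
  ultimately obtain jg where "is_arg_min (\<lambda>(k, h). - norm (p k h)) (\<lambda>kh. kh \<in> I \<times> Pi\<^sub>E I G) jg"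
    using ex_is_arg_min_if_finite by blast
  then obtain j g where j: "j \<in> I" and g: "g \<in> Pi\<^sub>E I G"
    and max: "\<And>k h. k \<in> I \<Longrightarrow> h \<in> Pi\<^sub>E I G \<Longrightarrow> norm (p k h) \<le> norm (p j g)"
    by (cases jg) (auto simp: is_arg_min_linorder)
  have "p j g \<in> D" if D: "D \<in> G j" for D
  proof -
    \<comment> \<open>The value of \<open>g\<close> at \<open>j\<close> does not enter
      \<open>p j g\<close>, so \<open>D\<close> can be put there.\<close>
    define h where "h = g(j := D)"
    have h: "h \<in> Pi\<^sub>E I G"
      using g j D by (auto simp: h_def PiE_iff extensional_def)
    then have "h \<in> Pi I G"
      by blast
    note h_part = part[OF this]
    define q where "q = closest_point (\<Inter>i\<in>I. h i) 0"
    have q: "q \<in> (\<Inter>i\<in>I. h i)"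
      unfolding q_def using h_part[of I] by (intro closest_point_in_set) auto
    have q_le: "norm q \<le> norm x" if "x \<in> (\<Inter>i\<in>I. h i)" for x
      using closest_point_le[OF _ that, of 0] h_part[of I] by (simp add: q_def)
    \<comment> \<open>The index \<open>k\<close> need not be \<open>j\<close>; this is why the
      maximum is taken over the omitted index as well.\<close>
    obtain k where "k \<in> I" and k: "\<And>x. x \<in> (\<Inter>i\<in>I - {k}. h i) \<Longrightarrow> norm q \<le> norm x"
    proof (rule Inter_disjoint_ball_imp_subfamily[OF \<open>finite I\<close> card_I])
      show "convex (h i)" if "i \<in> I" for i
        using that conv \<open>h \<in> Pi I G\<close> by blast
      show "(\<Inter>i\<in>I. h i) \<noteq> {}"
        using q by blast
    qed (use q_le in blast)+
    have "p k h \<in> (\<Inter>i\<in>I - {k}. h i)"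
      unfolding p_def using h_part[of "I - {k}"] by (intro closest_point_in_set) auto
    then have "norm q \<le> norm (p k h)"
      by (rule k)
    also have "\<dots> \<le> norm (p j g)"
      using max \<open>k \<in> I\<close> h by blast
    finally have q_p: "norm q \<le> norm (p j g)" .
    have g_part: "closed (\<Inter>i\<in>I - {j}. g i)" "convex (\<Inter>i\<in>I - {j}. g i)"
      using part[of g "I - {j}"] g by auto
    \<comment> \<open>\<open>q\<close> lies in the set whose nearest point to the origin is
      \<open>p j g\<close>, and is no farther away; nearest points of closed convex sets are
      unique.\<close>
    have "q = p j g"
      unfolding p_def
    proof (rule closest_point_unique[OF g_part(2,1)])
      show "q \<in> (\<Inter>i\<in>I - {j}. g i)"
        using q by (auto simp: h_def split: if_splits)
      show "\<forall>z\<in>\<Inter>i\<in>I - {j}. g i. dist 0 q \<le> dist 0 z"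
      proof
        fix z
        assume "z \<in> (\<Inter>i\<in>I - {j}. g i)"
        then have "norm (p j g) \<le> norm z"
          using closest_point_le[OF g_part(1), of z 0] by (simp add: p_def)
        with q_p show "dist 0 q \<le> dist 0 z"
          by simp
      qed
    qed
    moreover have "q \<in> D"
      using q j by (auto simp: h_def split: if_splits)
    ultimately show ?thesis
      by simp
  qed
  then show ?thesis
    using j by blast
qed

text \<open>By compactness, each family with empty intersection has a finite subfamily with empty
  intersection, which reduces the claim to finite families.\<close>

theorem colourful_helly_compact:
  fixes G :: "'i \<Rightarrow> 'a::euclidean_space set set"
  assumes "finite I" and "card I = DIM('a) + 1"
    and comp: "\<And>i S. i \<in> I \<Longrightarrow> S \<in> G i \<Longrightarrow> compact S"
    and conv: "\<And>i S. i \<in> I \<Longrightarrow> S \<in> G i \<Longrightarrow> convex S"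
    and meet: "\<And>g. g \<in> Pi I G \<Longrightarrow> (\<Inter>i\<in>I. g i) \<noteq> {}"
  shows "\<exists>i\<in>I. \<Inter>(G i) \<noteq> {}"
proof (rule ccontr)
  assume "\<not> ?thesis"
  then have "\<exists>H. finite H \<and> H \<subseteq> G i \<and> \<Inter>H = {}" if "i \<in> I" for i
    using that compact_fip_Heine_Borel[of "G i"] comp by metis
  then obtain H where H: "\<And>i. i \<in> I \<Longrightarrow> finite (H i) \<and> H i \<subseteq> G i \<and> \<Inter>(H i) = {}"
    by metis
  have "\<exists>i\<in>I. \<Inter>(H i) \<noteq> {}"
  proof (rule colourful_helly_finite[OF assms(1,2)])
    show "closed S" "convex S" if "i \<in> I" "S \<in> H i" for i S
      using that H comp conv by (blast intro: compact_imp_closed)+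
    show "(\<Inter>i\<in>I. g i) \<noteq> {}" if "g \<in> Pi I H" for g
      using that H by (intro meet) blast
  qed (use H in blast)
  then show False
    using H by blast
qed

section \<open>Visibility sets\<close>

definition visible_from :: "'a::real_vector set \<Rightarrow> 'a \<Rightarrow> 'a set"
  where "visible_from A y = {x. closed_segment x y \<subseteq> A}"

lemma visible_from_subset: "visible_from A y \<subseteq> A"
  by (auto simp: visible_from_def)

lemma closed_visible_from:
  fixes A :: "'a::real_normed_vector set"
  assumes "closed A"
  shows "closed (visible_from A y)"
proof -
  have "visible_from A y = (\<Inter>u\<in>{0..1}. (\<lambda>x. (1 - u) *\<^sub>R x + u *\<^sub>R y) -` A)"
    by (fastforce simp: visible_from_def closed_segment_def)
  moreover have "closed ((\<lambda>x. (1 - u) *\<^sub>R x + u *\<^sub>R y) -` A)" for u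
    using assms by (intro closed_vimage continuous_intros)
  ultimately show ?thesis
    by (simp add: closed_INT)
qed

text \<open>From \<open>b\<close>, a step towards a visible point beyond the hyperplane would stay
  in \<open>A\<close> and come closer to \<open>w\<close>. The half-space is convex, so it also
  contains the hull.\<close>

lemma visible_from_nearest_point_halfspace:
  fixes A :: "'a::real_inner set"
  assumes nearest: "\<And>p. p \<in> A \<Longrightarrow> dist b w \<le> dist p w"
  shows "convex hull (visible_from A b) \<subseteq> {v. (w - b) \<bullet> v \<le> (w - b) \<bullet> b}"
proof (rule hull_minimal)
  show "visible_from A b \<subseteq> {v. (w - b) \<bullet> v \<le> (w - b) \<bullet> b}"
  proof (rule ccontr)
    assume "\<not> ?thesis"
    then obtain v where "v \<in> visible_from A b" and "(w - b) \<bullet> v > (w - b) \<bullet> b"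
      unfolding subset_iff mem_Collect_eq by (meson not_le)
    then have seg: "closed_segment v b \<subseteq> A" and "(w - b) \<bullet> (v - b) > 0"
      by (auto simp: visible_from_def inner_diff_right)
    then obtain u where "u > 0" "u \<le> 1" and closer: "dist (b + u *\<^sub>R (v - b)) w < dist b w"
      using closer_point_lemma by blast
    moreover have "b + u *\<^sub>R (v - b) = (1 - u) *\<^sub>R b + u *\<^sub>R v"
      by (simp add: algebra_simps)
    ultimately have "b + u *\<^sub>R (v - b) \<in> closed_segment b v"
      unfolding in_segment by (metis order_less_imp_le)
    then show False
      using seg nearest closer by (force simp: closed_segment_commute)
  qed
qed (rule convex_halfspace_le)

text \<open>Given a point of the segment outside \<open>A\<close>, a suitable \<open>w t\<close> on
  the segment has a nearest point \<open>b\<close> in \<open>A\<close> such that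
  \<open>w t - b\<close> has negative inner product with \<open>y - x\<close>. The half-space at
  \<open>b\<close> contains \<open>x\<close>, and hence also \<open>w t\<close>, which is
  impossible.\<close>

lemma convex_hull_visible_from_imp_visible:
  fixes A :: "'a::euclidean_space set"
  assumes "compact A" and "y \<in> A"
    and hull: "\<And>b. b \<in> A \<Longrightarrow> x \<in> convex hull (visible_from A b)"
  shows "closed_segment x y \<subseteq> A"
proof (rule ccontr)
  assume "\<not> ?thesis"
  then obtain z where "z \<in> closed_segment x y" "z \<notin> A"
    by blast
  then obtain s where s: "0 \<le> s" "s \<le> 1" and "z = (1 - s) *\<^sub>R x + s *\<^sub>R y"
    by (auto simp: closed_segment_def)
  define w where "w t = x + t *\<^sub>R (y - x)" for t
  have "w s \<notin> A" "w 1 = y"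
    using \<open>z \<notin> A\<close> \<open>z = _\<close> by (auto simp: w_def algebra_simps)
  with \<open>y \<in> A\<close> have "s < 1"
    using s by (metis order_le_less)
  obtain e where "e > 0" and e: "\<And>p. p \<in> A \<Longrightarrow> e \<le> dist (w s) p"
    using separate_point_closed[OF compact_imp_closed[OF \<open>compact A\<close>] \<open>w s \<notin> A\<close>] by blast
  have "y \<noteq> x"
    using \<open>w s \<notin> A\<close> \<open>y \<in> A\<close> by (auto simp: w_def)
  define c where "c = e\<^sup>2"
  have "c > 0"
    using \<open>e > 0\<close> by (simp add: c_def)
  txt \<open>
    The second summand forces the minimiser to lie where moving towards \<open>x\<close> increases the
    distance to \<open>A\<close>, and its coefficient is too small for the minimum to be attained at \<open>s\<close>.
  \<close>
  define f where "f = (\<lambda>(t, p). (dist (w t) p)\<^sup>2 + c / 2 * (t - s))"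
  have "continuous_on ({s..1} \<times> A) f"
    unfolding f_def w_def case_prod_unfold by (intro continuous_intros)
  moreover have "compact ({s..1} \<times> A)" "{s..1} \<times> A \<noteq> {}"
    using \<open>compact A\<close> \<open>y \<in> A\<close> s by (auto intro: compact_Times)
  ultimately obtain tb where "tb \<in> {s..1} \<times> A" "\<And>q. q \<in> {s..1} \<times> A \<Longrightarrow> f tb \<le> f q"
    using continuous_attains_inf[of "{s..1} \<times> A" f] by blast
  then obtain t b where t: "s \<le> t" "t \<le> 1" and "b \<in> A"
    and min: "\<And>u p. s \<le> u \<Longrightarrow> u \<le> 1 \<Longrightarrow> p \<in> A \<Longrightarrow> f (t, b) \<le> f (u, p)"
    by (cases tb) auto
  \<comment> \<open>At \<open>t = s\<close> the value of \<open>f\<close> is at least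
    \<open>c\<close>; at \<open>(1, y)\<close> the distance vanishes and at most
    \<open>c / 2\<close> remains.\<close>
  have "t \<noteq> s"
  proof
    assume "t = s"
    have "c \<le> (dist (w s) b)\<^sup>2"
      unfolding c_def using e[OF \<open>b \<in> A\<close>] \<open>e > 0\<close> by (intro power_mono) auto
    moreover have "f (t, b) \<le> f (1, y)"
      using min s \<open>y \<in> A\<close> by simp
    ultimately have "c \<le> c / 2 * (1 - s)"
      using \<open>t = s\<close> \<open>w 1 = y\<close> by (simp add: f_def)
    moreover have "c / 2 * (1 - s) \<le> c / 2 * 1"
      using s \<open>c > 0\<close> by (intro mult_left_mono) auto
    ultimately show False
      using \<open>c > 0\<close> by simp
  qed
  with t have "s < t"
    by simp
  have towards_x: "(w t - b) \<bullet> (y - x) < 0"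
  proof (rule ccontr)
    assume "\<not> ?thesis"
    then have nonneg: "(w t - b) \<bullet> (y - x) \<ge> 0"
      by simp
    define n where "n = (norm (y - x))\<^sup>2"
    have "n > 0"
      using \<open>y \<noteq> x\<close> by (simp add: n_def)
    \<comment> \<open>The first bound keeps \<open>t - u\<close> in the range of the minimisation;
      the second makes the quadratic term \<open>u * (u * n)\<close> smaller than the gain
      \<open>u * (c / 2)\<close> from the linear summand.\<close>
    define u where "u = min (t - s) (c / (4 * n))"
    have u: "0 < u" "u \<le> t - s" "u * n < c / 2"
    proof -
      show "0 < u" "u \<le> t - s"
        using \<open>s < t\<close> \<open>c > 0\<close> \<open>n > 0\<close> by (auto simp: u_def)
      have "u * n \<le> c / (4 * n) * n"
        using \<open>n > 0\<close> by (intro mult_right_mono) (auto simp: u_def)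
      also have "\<dots> < c / 2"
        using \<open>n > 0\<close> \<open>c > 0\<close> by simp
      finally show "u * n < c / 2" .
    qed
    have "w (t - u) - b = (w t - b) - u *\<^sub>R (y - x)"
      by (simp add: w_def algebra_simps)
    moreover have "(norm (a - u *\<^sub>R v))\<^sup>2 = (norm a)\<^sup>2 - 2 * u * (a \<bullet> v) + u * (u * (norm v)\<^sup>2)" for a v :: 'a
      by (simp add: power2_norm_eq_inner inner_diff_left inner_diff_right inner_commute algebra_simps)
    ultimately have "(dist (w (t - u)) b)\<^sup>2
        = (dist (w t) b)\<^sup>2 - 2 * u * ((w t - b) \<bullet> (y - x)) + u * (u * n)"
      by (simp only: dist_norm n_def)
    moreover have "f (t, b) \<le> f (t - u, b)"
      using min t u \<open>b \<in> A\<close> by simp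
    then have "(dist (w t) b)\<^sup>2 + c / 2 * (t - s) \<le> (dist (w (t - u)) b)\<^sup>2 + c / 2 * (t - u - s)"
      by (simp add: f_def)
    moreover have "c / 2 * (t - u - s) = c / 2 * (t - s) - u * (c / 2)"
      by (simp add: field_simps)
    ultimately have "u * (c / 2) + 2 * u * ((w t - b) \<bullet> (y - x)) \<le> u * (u * n)"
      by linarith
    moreover have "0 \<le> 2 * u * ((w t - b) \<bullet> (y - x))"
      using u nonneg by simp
    moreover have "u * (u * n) < u * (c / 2)"
      using u by simp
    ultimately show False
      by linarith
  qed
  \<comment> \<open>For fixed \<open>t\<close> the linear summand of \<open>f\<close> is constant,
    so \<open>b\<close> is nearest to \<open>w t\<close>.\<close>
  have "dist b (w t) \<le> dist p (w t)" if "p \<in> A" for p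
    using min[of t p] t that by (simp add: f_def dist_commute power2_le_iff_abs_le)
  then have "(w t - b) \<bullet> x \<le> (w t - b) \<bullet> b"
    using visible_from_nearest_point_halfspace[of A b "w t"] hull[OF \<open>b \<in> A\<close>] by blast
  moreover have "(w t - b) \<bullet> (w t - b) = (w t - b) \<bullet> x + t * ((w t - b) \<bullet> (y - x)) - (w t - b) \<bullet> b"
    by (subst (2) w_def) (simp add: inner_diff_right inner_add_right)
  moreover have "t * ((w t - b) \<bullet> (y - x)) < 0"
    using towards_x \<open>s < t\<close> s by (simp add: mult_pos_neg)
  ultimately have "(w t - b) \<bullet> (w t - b) < 0"
    by linarith
  then show False
    using inner_ge_zero[of "w t - b"] by linarith
qed

theorem theorem2p2:
  fixes K :: "(real ^ 'd) set"
    and F :: "nat \<Rightarrow> (real ^ 'd) set"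
  assumes "compact K"
    and "\<And>i. i \<in> {1..CARD('d) + 1} \<Longrightarrow> closed (F i) \<and> F i \<subseteq> K \<and> F i \<noteq> {}"
    and "\<And>f :: nat \<Rightarrow> real ^ 'd. (\<And>i. i \<in> {1..CARD('d) + 1} \<Longrightarrow> f i \<in> F i) \<Longrightarrow>
           \<exists>x\<in>K. \<forall>i\<in>{1..CARD('d) + 1}. closed_segment x (f i) \<subseteq> F i"
  shows "\<exists>i\<in>{1..CARD('d) + 1}. starlike (F i)"
proof -
  let ?I = "{1..CARD('d) + 1}"
  have comp: "compact (F i)" if "i \<in> ?I" for i
    using assms(1,2) that by (metis compact_Int_closed inf.absorb_iff2)
  define G where "G i = (\<lambda>y. convex hull (visible_from (F i) y)) ` F i" for i
  have "\<exists>i\<in>?I. \<Inter>(G i) \<noteq> {}"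
  proof (rule colourful_helly_compact)
    show "compact S" if "i \<in> ?I" "S \<in> G i" for i S
    proof -
      obtain y where "S = convex hull (visible_from (F i) y)"
        using \<open>S \<in> G i\<close> by (auto simp: G_def)
      moreover have "compact (visible_from (F i) y)"
        using comp[OF \<open>i \<in> ?I\<close>] by (meson closed_visible_from compact_eq_bounded_closed
            bounded_subset visible_from_subset)
      ultimately show ?thesis
        by (simp add: compact_convex_hull)
    qed
    show "convex S" if "S \<in> G i" for i S
      using that by (auto simp: G_def)
    show "(\<Inter>i\<in>?I. g i) \<noteq> {}" if "g \<in> Pi ?I G" for g
    proof -
      \<comment> \<open>Choosing members of the families \<open>G i\<close> amounts to choosing
        points \<open>f i\<close>, and the hypothesis supplies a point that sees all of
        them.\<close>
      have "\<forall>i\<in>?I. \<exists>y\<in>F i. g i = convex hull (visible_from (F i) y)"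
        using that by (auto simp: G_def Pi_iff)
      then obtain f where f: "\<And>i. i \<in> ?I \<Longrightarrow> f i \<in> F i"
        "\<And>i. i \<in> ?I \<Longrightarrow> g i = convex hull (visible_from (F i) (f i))"
        by metis
      then obtain x where "\<And>i. i \<in> ?I \<Longrightarrow> x \<in> visible_from (F i) (f i)"
        using assms(3)[of f] unfolding visible_from_def by blast
      then have "x \<in> (\<Inter>i\<in>?I. g i)"
        using f(2) by (auto intro: hull_inc)
      then show ?thesis
        by blast
    qed
  qed simp_all
  then obtain i x where i: "i \<in> ?I" and "x \<in> \<Inter>(G i)"
    by blast
  then have "x \<in> convex hull (visible_from (F i) y)" if "y \<in> F i" for y
    using that by (simp add: G_def)
  then have seg: "closed_segment x y \<subseteq> F i" if "y \<in> F i" for y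
    using convex_hull_visible_from_imp_visible[OF comp[OF i] that] by blast
  \<comment> \<open>Non-emptiness of \<open>F i\<close> provides a segment inside \<open>F i\<close>
    that starts at \<open>x\<close>.\<close>
  moreover have "x \<in> F i"
    using assms(2)[OF i] seg ends_in_segment(1) by blast
  ultimately show ?thesis
    using i unfolding starlike_def by blast
qed

end
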